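(* Let $n\ge1$, $w\in\mathbb{R}^n_{>0}$, $c_0\in\mathbb{R}^n$, $r_0>0$, $B_0=\mathcal{B}(c_0,r_0w)$ and $0<\varepsilon<r_0$. Any deterministic binary-comparison algorithm which, for every translated spherical quadratic $f_z(x)=\tfrac12\|x-z\|_2^2$ with target $z\in B_0$, is guaranteed to output a point $\widehat x$ with $\|\widehat x-z\|_{\infty,w}\le\varepsilon$ needs in the worst case at least $$N\ge n\log_2(r_0/\varepsilon)$$ binary comparisons. A randomised algorithm with a fixed budget of $N$ binary comparisons whose output satisfies $\|\widehat x-z\|_{\infty,w}\le\varepsilon$ with probability at least $1-\delta$ for every target $z\in B_0$ (where $0<\delta<1$) satisfies $$N\ge n\log_2(r_0/\varepsilon)+\log_2(1-\delta).$$
   Context: $\mathcal{B}(c,r)=\{x:|x_i-c_i|\le r_i\ \forall i\}$; $\|u\|_{\infty,w}=\max_i|u_i|/w_i$. A binary comparison of two points $a,b$ returns $+1$ if $f(a)>f(b)$ and $-1$ if $f(a)<f(b)$; at equality it returns one of the two binary answers (there is no third answer). A deterministic algorithm chooses each compared pair adaptively as a function of previous binary answers, and its output is a function of the answers; a randomised algorithm is a random choice of a deterministic one. *)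

theory Defs
  imports "HOL-Probability.Probability"
begin

definition weighted_box :: "real ^ 'n \<Rightarrow> real ^ 'n \<Rightarrow> (real ^ 'n) set" where
  "weighted_box c r = {x. \<forall>i. \<bar>x $ i - c $ i\<bar> \<le> r $ i}"

definition weighted_sup_norm :: "real ^ 'n \<Rightarrow> real ^ 'n \<Rightarrow> real" where
  "weighted_sup_norm w u = Max (range (\<lambda>i. \<bar>u $ i\<bar> / w $ i))"

definition spherical_quadratic :: "real ^ 'n \<Rightarrow> real ^ 'n \<Rightarrow> real" where
  "spherical_quadratic z x = (1 / 2) * (norm (x - z))\<^sup>2"

text \<open>
  An answer is a Boolean: True stands for the answer +1 and False for -1.
  A deterministic algorithm maps the answers received so far (oldest first) either to the next
  pair to compare or to its output. It may use a different number of comparisons on different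
  targets, and nothing forces it to stop.
\<close>

datatype 'p action = Compare 'p 'p | Output 'p

type_synonym 'p algorithm = "bool list \<Rightarrow> 'p action"

text \<open>
  A comparer receives the objective, the earlier answers and the compared pair. Only its answers
  at ties are free; they may depend on the objective and on the earlier answers, so that repeating
  a tied comparison need not give the same answer twice.
\<close>

type_synonym 'p comparer = "('p \<Rightarrow> real) \<Rightarrow> bool list \<Rightarrow> 'p \<Rightarrow> 'p \<Rightarrow> bool"

definition valid_comparer :: "'p comparer \<Rightarrow> bool" where
  "valid_comparer cmp \<longleftrightarrow>
     (\<forall>f h a b. (f a > f b \<longrightarrow> cmp f h a b) \<and> (f a < f b \<longrightarrow> \<not> cmp f h a b))"

text \<open>The answers received within the first \<open>k\<close> steps; constant once the algorithm has stopped.\<close>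

primrec answers :: "'p algorithm \<Rightarrow> 'p comparer \<Rightarrow> ('p \<Rightarrow> real) \<Rightarrow> nat \<Rightarrow> bool list" where
  "answers alg cmp f 0 = []"
| "answers alg cmp f (Suc k) =
     (let h = answers alg cmp f k in
      case alg h of Compare a b \<Rightarrow> h @ [cmp f h a b] | Output x \<Rightarrow> h)"

definition outputs :: "'p algorithm \<Rightarrow> 'p comparer \<Rightarrow> ('p \<Rightarrow> real) \<Rightarrow> 'p \<Rightarrow> bool" where
  "outputs alg cmp f x \<longleftrightarrow> (\<exists>k. alg (answers alg cmp f k) = Output x)"

text \<open>The number of comparisons made on \<open>f\<close>; it is \<open>\<infinity>\<close> exactly if the algorithm never stops.\<close>

definition comparisons :: "'p algorithm \<Rightarrow> 'p comparer \<Rightarrow> ('p \<Rightarrow> real) \<Rightarrow> enat" where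
  "comparisons alg cmp f = (SUP k. enat (length (answers alg cmp f k)))"

definition locates ::
  "(real ^ 'n) algorithm \<Rightarrow> (real ^ 'n) comparer \<Rightarrow> real ^ 'n \<Rightarrow> real \<Rightarrow> real ^ 'n \<Rightarrow> bool" where
  "locates alg cmp w \<epsilon> z \<longleftrightarrow>
     (\<exists>x. outputs alg cmp (spherical_quadratic z) x \<and> weighted_sup_norm w (x - z) \<le> \<epsilon>)"

definition worst_case_comparisons ::
  "(real ^ 'n) algorithm \<Rightarrow> (real ^ 'n) comparer \<Rightarrow> (real ^ 'n) set \<Rightarrow> enat" where
  "worst_case_comparisons alg cmp B =
     (SUP z\<in>B. comparisons alg cmp (spherical_quadratic z))"

end

theory Submission
  imports Defs "HOL-Real_Asymp.Real_Asymp"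
begin

text \<open>
  The argument is a count. A run that makes at most \<open>N\<close> comparisons is determined by the bits it
  receives, so a deterministic algorithm with a fixed rule for ties has at most \<open>2 ^ N\<close> outputs
  over all objectives together (\<open>reachable_outputs\<close>). Each output serves only
  targets in a box of relative radius \<open>\<epsilon>\<close>. So the targets it locates are covered by \<open>2 ^ N\<close> small
  boxes, and comparing volumes with the large box would give \<open>r\<^sub>0 ^ n \<le> 2 ^ N * \<epsilon> ^ n\<close>.

  For a randomised algorithm one would average this over a uniformly distributed target, but
  exchanging the two integrals needs the success event to be jointly measurable in the seed and the
  target, which is not given. The volume is therefore replaced by counting in a uniform grid with
  \<open>m + 1\<close> points per axis: a small box contains at most \<open>(\<epsilon> m / r\<^sub>0 + 1) ^ n\<close> of the
  \<open>(m + 1) ^ n\<close> grid points (\<open>card_grid_indices_near\<close>). Only finitely many events occur, and each is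
  measurable because its probability is positive, so a finite double count gives
  \<open>(1 - \<delta>) (m + 1) ^ n \<le> 2 ^ N (\<epsilon> m / r\<^sub>0 + 1) ^ n\<close>. The limit \<open>m \<rightarrow> \<infinity>\<close> recovers the bound
  without loss (\<open>grid_count_limit\<close>). The deterministic case is the same count with success
  proportion \<open>1\<close>.
\<close>

section \<open>Outputs reachable within a comparison budget\<close>

lemma compares_before_answers_end:
  assumes "j < length (answers alg cmp f k)"
  shows "\<exists>a b. alg (take j (answers alg cmp f k)) = Compare a b"
  using assms
proof (induction k)
  case 0
  then show ?case by simp
next
  case (Suc k)
  show ?case
  proof (cases "alg (answers alg cmp f k)")
    case (Compare a b)
    then show ?thesis
      using Suc by (cases "j = length (answers alg cmp f k)") (auto simp: Let_def)
  next
    case (Output x)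
    then show ?thesis using Suc by (simp add: Let_def)
  qed
qed

lemma length_answers_le_comparisons:
  assumes "comparisons alg cmp f \<le> enat N"
  shows "length (answers alg cmp f k) \<le> N"
proof -
  have "enat (length (answers alg cmp f k)) \<le> comparisons alg cmp f"
    unfolding comparisons_def by (rule SUP_upper) simp
  also note assms
  finally show ?thesis by simp
qed

text \<open>
  A run can be replayed from its answers padded to length \<open>N\<close>: every proper prefix of the answers
  leads to a further comparison, so the algorithm stops on the first prefix of the padded list on
  which it outputs at all, and the padding is never read. Hence bit strings of length \<open>N\<close> suffice
  to name all outputs, although the answers themselves vary in length.
\<close>

lemma reachable_outputs:
  fixes alg :: "'p algorithm" and cmp :: "'p comparer" and N :: nat
  defines "X \<equiv> {x. \<exists>f. outputs alg cmp f x \<and> comparisons alg cmp f \<le> enat N}"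
  shows "finite X" and "card X \<le> 2 ^ N"
proof -
  define stop where "stop bs = (LEAST k. \<exists>x. alg (take k bs) = Output x)" for bs
  define replay where
    "replay bs = (case alg (take (stop bs) bs) of Output x \<Rightarrow> x | Compare a b \<Rightarrow> a)" for bs
  define L where "L = {bs :: bool list. set bs \<subseteq> UNIV \<and> length bs = N}"
  have L: "finite L" "card L = 2 ^ N"
    unfolding L_def
    by (rule finite_lists_length_eq, simp, subst card_lists_length_eq, simp_all)
  have "X \<subseteq> replay ` L"
  proof
    fix x assume "x \<in> X"
    then obtain f k where x: "alg (answers alg cmp f k) = Output x"
      and N: "comparisons alg cmp f \<le> enat N"
      by (auto simp: X_def outputs_def)
    define h where "h = answers alg cmp f k"
    define bs where "bs = h @ replicate (N - length h) False"
    have len: "length h \<le> N"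
      using length_answers_le_comparisons[OF N] by (simp add: h_def)
    have "stop bs = length h"
      unfolding stop_def
    proof (rule Least_equality)
      show "\<exists>x. alg (take (length h) bs) = Output x"
        using x by (simp add: bs_def h_def)
    next
      fix j assume j: "\<exists>x. alg (take j bs) = Output x"
      show "length h \<le> j"
      proof (rule ccontr)
        assume "\<not> length h \<le> j"
        with j compares_before_answers_end[of j alg cmp f k] show False
          by (auto simp: bs_def h_def)
      qed
    qed
    then have "replay bs = x"
      using x by (simp add: replay_def bs_def h_def)
    moreover have "bs \<in> L"
      using len by (simp add: L_def bs_def)
    ultimately show "x \<in> replay ` L" by blast
  qed
  then show "finite X" "card X \<le> 2 ^ N"
    using L finite_surj[of L X replay] surj_card_le[of L X replay] by auto
qed

section \<open>Grid points in a small box\<close>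

lemma card_nats_near_real:
  fixes a t :: real
  assumes "0 \<le> t"
  shows "finite {k::nat. \<bar>real k - a\<bar> \<le> t}" and "real (card {k::nat. \<bar>real k - a\<bar> \<le> t}) \<le> 2 * t + 1"
proof -
  define S where "S = {k::nat. \<bar>real k - a\<bar> \<le> t}"
  have "S \<subseteq> {.. nat \<lceil>a + t\<rceil>}"
  proof
    fix k assume "k \<in> S"
    then have "real k \<le> a + t" by (simp add: S_def abs_le_iff)
    then show "k \<in> {.. nat \<lceil>a + t\<rceil>}" by (simp, linarith)
  qed
  then show fin: "finite {k::nat. \<bar>real k - a\<bar> \<le> t}"
    unfolding S_def by (rule finite_subset) simp
  have "real (card S) \<le> 2 * t + 1"
  proof (cases "S = {}")
    case True
    then show ?thesis using assms by simp
  next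
    case False
    have mem: "Min S \<in> S" "Max S \<in> S"
      using Min_in[of S] Max_in[of S] fin False by (simp_all add: S_def)
    have "S \<subseteq> {Min S..Max S}"
      using fin by (auto simp: S_def)
    then have "card S \<le> card {Min S..Max S}"
      by (rule card_mono[rotated]) simp
    then have "real (card S) \<le> real (Max S) - real (Min S) + 1"
      using Max_ge[OF _ mem(1)] fin[folded S_def] by simp
    also have "\<dots> \<le> 2 * t + 1"
      using mem by (simp add: S_def abs_le_iff)
    finally show ?thesis .
  qed
  then show "real (card {k::nat. \<bar>real k - a\<bar> \<le> t}) \<le> 2 * t + 1"
    by (simp add: S_def)
qed

definition grid_indices :: "nat \<Rightarrow> ('n \<Rightarrow> nat) set" where
  "grid_indices m = Pi\<^sub>E UNIV (\<lambda>_. {..m})"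

definition grid_point ::
  "real ^ 'n \<Rightarrow> real \<Rightarrow> real ^ 'n \<Rightarrow> nat \<Rightarrow> ('n \<Rightarrow> nat) \<Rightarrow> real ^ 'n" where
  "grid_point c r w m k = (\<chi> i. c $ i + r * w $ i * (2 * real (k i) / real m - 1))"

lemma finite_grid_indices: "finite (grid_indices m :: ('n::finite \<Rightarrow> nat) set)"
  by (simp add: grid_indices_def finite_PiE)

lemma card_grid_indices: "card (grid_indices m :: ('n::finite \<Rightarrow> nat) set) = (m + 1) ^ CARD('n)"
  by (simp add: grid_indices_def card_PiE)

lemma grid_point_in_weighted_box:
  assumes "\<forall>i. 0 < w $ i" "0 < r" "0 < m" "k \<in> grid_indices m"
  shows "grid_point c r w m k \<in> weighted_box c (r *\<^sub>R w)"
proof -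
  have "\<bar>r * w $ i * (2 * real (k i) / real m - 1)\<bar> \<le> r * w $ i" for i
  proof -
    have "k i \<le> m" using assms(4) by (auto simp: grid_indices_def PiE_iff)
    then have "real (k i) / real m \<le> 1" using assms(3) by simp
    moreover have "0 \<le> real (k i) / real m" by simp
    ultimately have "\<bar>2 * real (k i) / real m - 1\<bar> \<le> 1" by (simp add: abs_le_iff)
    moreover have "0 < r * w $ i" using assms by simp
    ultimately show ?thesis
      by (simp only: abs_mult[of "r * w $ i"] abs_of_pos) (rule mult_left_le, simp_all)
  qed
  then show ?thesis by (simp add: weighted_box_def grid_point_def)
qed

lemma weighted_sup_norm_le_iff:
  fixes w u :: "real ^ 'n"
  assumes "\<forall>i. 0 < w $ i"
  shows "weighted_sup_norm w u \<le> e \<longleftrightarrow> (\<forall>i. \<bar>u $ i\<bar> \<le> e * w $ i)"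
  using assms by (simp add: weighted_sup_norm_def pos_divide_le_eq)

text \<open>
  In units of the grid spacing \<open>2 * r * w $ i / m\<close>, the small box has side length \<open>e * m / r\<close> along
  every axis, and an interval of length \<open>s\<close> contains at most \<open>s + 1\<close> integers.
\<close>

lemma card_grid_indices_near:
  fixes x w :: "real ^ 'n"
  assumes w: "\<forall>i. 0 < w $ i" and r: "0 < r" and m: "0 < m" and e: "0 \<le> e"
  shows "real (card {k \<in> grid_indices m. weighted_sup_norm w (x - grid_point c r w m k) \<le> e})
           \<le> (e * real m / r + 1) ^ CARD('n)"
proof -
  define t where "t = e * real m / (2 * r)"
  define a where "a i = (real m / 2) * ((x $ i - c $ i) / (r * w $ i) + 1)" for i
  have t: "0 \<le> t" using r e by (simp add: t_def)
  have "{k \<in> grid_indices m. weighted_sup_norm w (x - grid_point c r w m k) \<le> e}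
          \<subseteq> Pi\<^sub>E UNIV (\<lambda>i. {j. \<bar>real j - a i\<bar> \<le> t})"
  proof
    fix k assume "k \<in> {k \<in> grid_indices m. weighted_sup_norm w (x - grid_point c r w m k) \<le> e}"
    then have near: "\<bar>(x - grid_point c r w m k) $ i\<bar> \<le> e * w $ i" for i
      by (simp add: weighted_sup_norm_le_iff[OF w])
    have "\<bar>real (k i) - a i\<bar> \<le> t" for i
    proof -
      have wi: "0 < w $ i" using w by simp
      define s where "s = real m / (2 * r * w $ i)"
      have s: "0 < s" using wi r m by (simp add: s_def)
      have "real (k i) - a i = - s * (x - grid_point c r w m k) $ i"
        using wi r m by (simp add: s_def a_def grid_point_def field_simps)
      then have "\<bar>real (k i) - a i\<bar> = s * \<bar>(x - grid_point c r w m k) $ i\<bar>"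
        using s by (simp add: abs_mult)
      also have "\<dots> \<le> s * (e * w $ i)"
        using near[of i] s by (intro mult_left_mono) auto
      also have "\<dots> = t"
        using wi r by (simp add: s_def t_def)
      finally show ?thesis .
    qed
    then show "k \<in> Pi\<^sub>E UNIV (\<lambda>i. {j. \<bar>real j - a i\<bar> \<le> t})" by auto
  qed
  then have "card {k \<in> grid_indices m. weighted_sup_norm w (x - grid_point c r w m k) \<le> e}
          \<le> card (Pi\<^sub>E (UNIV :: 'n set) (\<lambda>i. {j::nat. \<bar>real j - a i\<bar> \<le> t}))"
    by (rule card_mono[rotated]) (intro finite_PiE finite card_nats_near_real(1)[OF t])
  also have "\<dots> = (\<Prod>i\<in>UNIV. card {j::nat. \<bar>real j - a i\<bar> \<le> t})"
    by (simp add: card_PiE)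
  finally have "real (card {k \<in> grid_indices m. weighted_sup_norm w (x - grid_point c r w m k) \<le> e})
          \<le> (\<Prod>i\<in>UNIV. real (card {j::nat. \<bar>real j - a i\<bar> \<le> t}))"
    by (simp flip: of_nat_prod)
  also have "\<dots> \<le> (\<Prod>i\<in>(UNIV :: 'n set). 2 * t + 1)"
    by (intro prod_mono conjI card_nats_near_real(2)[OF t]) simp
  also have "\<dots> = (e * real m / r + 1) ^ CARD('n)"
    by (simp add: t_def)
  finally show ?thesis .
qed

text \<open>
  A located grid point lies near one of the at most \<open>2 ^ N\<close> reachable outputs, so the small boxes
  around these outputs cover all located grid points.
\<close>

lemma card_located_grid_indices:
  fixes w c :: "real ^ 'n"
  assumes w: "\<forall>i. 0 < w $ i" and r: "0 < r" and m: "0 < m" and e: "0 \<le> e"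
    and budget: "worst_case_comparisons alg cmp (weighted_box c (r *\<^sub>R w)) \<le> enat N"
  shows "real (card {k \<in> grid_indices m. locates alg cmp w e (grid_point c r w m k)})
           \<le> 2 ^ N * (e * real m / r + 1) ^ CARD('n)"
proof -
  define X where "X = {x. \<exists>f. outputs alg cmp f x \<and> comparisons alg cmp f \<le> enat N}"
  define near where
    "near x = {k \<in> grid_indices m. weighted_sup_norm w (x - grid_point c r w m k) \<le> e}" for x
  have X: "finite X" "card X \<le> 2 ^ N"
    unfolding X_def by (rule reachable_outputs)+
  have "{k \<in> grid_indices m. locates alg cmp w e (grid_point c r w m k)} \<subseteq> (\<Union>x\<in>X. near x)"
  proof
    fix k assume "k \<in> {k \<in> grid_indices m. locates alg cmp w e (grid_point c r w m k)}"
    then obtain x where k: "k \<in> grid_indices m"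
      and x: "outputs alg cmp (spherical_quadratic (grid_point c r w m k)) x"
        "weighted_sup_norm w (x - grid_point c r w m k) \<le> e"
      by (auto simp: locates_def)
    have "comparisons alg cmp (spherical_quadratic (grid_point c r w m k))
            \<le> worst_case_comparisons alg cmp (weighted_box c (r *\<^sub>R w))"
      unfolding worst_case_comparisons_def
      by (rule SUP_upper) (rule grid_point_in_weighted_box[OF w r m k])
    with budget x(1) have "x \<in> X"
      unfolding X_def using order_trans by blast
    with k x(2) show "k \<in> (\<Union>x\<in>X. near x)" by (auto simp: near_def)
  qed
  then have "card {k \<in> grid_indices m. locates alg cmp w e (grid_point c r w m k)}
               \<le> card (\<Union>x\<in>X. near x)"
    using X(1) by (intro card_mono) (auto simp: near_def finite_grid_indices)
  also have "\<dots> \<le> (\<Sum>x\<in>X. card (near x))"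
    by (rule card_UN_le[OF X(1)])
  finally have "real (card {k \<in> grid_indices m. locates alg cmp w e (grid_point c r w m k)})
               \<le> (\<Sum>x\<in>X. real (card (near x)))"
    by (simp flip: of_nat_sum)
  also have "\<dots> \<le> (\<Sum>x\<in>X. (e * real m / r + 1) ^ CARD('n))"
    unfolding near_def by (intro sum_mono card_grid_indices_near w r m e)
  also have "\<dots> = real (card X) * (e * real m / r + 1) ^ CARD('n)"
    by simp
  also have "\<dots> \<le> 2 ^ N * (e * real m / r + 1) ^ CARD('n)"
    using X(2) r e by (intro mult_right_mono) (simp_all flip: of_nat_power_le_of_nat_cancel_iff)
  finally show ?thesis .
qed

section \<open>Averaging over the grid and refining it\<close>

text \<open>
  Double counting of the pairs of an outcome and an index whose event it belongs to. The library
  assigns measure \<open>0\<close> to sets that are not measurable, so the positive lower bound \<open>p\<close> already makes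
  every set measurable.
\<close>

lemma (in prob_space) mean_card_events_le:
  fixes I :: "'i set" and p C :: real
  assumes "finite I" and p: "0 < p"
    and likely: "\<And>i. i \<in> I \<Longrightarrow> p \<le> \<P>(\<omega> in M. Q \<omega> i)"
    and few: "\<And>\<omega>. \<omega> \<in> space M \<Longrightarrow> real (card {i \<in> I. Q \<omega> i}) \<le> C"
  shows "p * real (card I) \<le> C"
proof -
  define E where "E i = {\<omega> \<in> space M. Q \<omega> i}" for i
  have E: "E i \<in> events" if "i \<in> I" for i
  proof (rule ccontr)
    assume "E i \<notin> events"
    then have "prob (E i) = 0" by (rule measure_notin_sets)
    with likely[OF that] p show False by (simp add: E_def)
  qed
  have int: "integrable M (\<lambda>\<omega>. indicat_real (E i) \<omega>)" if "i \<in> I" for i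
    using E[OF that] by (simp add: integrable_indicator_iff less_top[symmetric])
  have "p * real (card I) = (\<Sum>i\<in>I. p)" by simp
  also have "\<dots> \<le> (\<Sum>i\<in>I. prob (E i))"
    unfolding E_def by (intro sum_mono likely)
  also have "\<dots> = (\<Sum>i\<in>I. \<integral>\<omega>. indicat_real (E i) \<omega> \<partial>M)"
    using E by (intro sum.cong) auto
  also have "\<dots> = (\<integral>\<omega>. (\<Sum>i\<in>I. indicat_real (E i) \<omega>) \<partial>M)"
    by (subst Bochner_Integration.integral_sum) (auto intro: int)
  also have "\<dots> \<le> (\<integral>\<omega>. C \<partial>M)"
  proof (rule integral_mono)
    fix \<omega> assume \<omega>: "\<omega> \<in> space M"
    have "(\<Sum>i\<in>I. indicat_real (E i) \<omega>) = (\<Sum>i\<in>I. if Q \<omega> i then 1 else 0)"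
      using \<omega> by (intro sum.cong) (auto simp: E_def indicator_def)
    also have "\<dots> = real (card {i \<in> I. Q \<omega> i})"
      using \<open>finite I\<close> by (simp add: sum.If_cases Int_def)
    finally show "(\<Sum>i\<in>I. indicat_real (E i) \<omega>) \<le> C"
      using few[OF \<omega>] by simp
  qed (auto intro: int)
  also have "\<dots> = C" by (simp add: prob_space)
  finally show ?thesis .
qed

text \<open>
  Along one axis, the bound on the proportion of grid values inside a small box tends to \<open>e / r\<close>,
  the ratio of the side lengths: the rounding error \<open>+ 1\<close> disappears in the limit.
\<close>

lemma grid_count_limit:
  fixes p e r :: real and n N :: nat
  assumes p: "0 < p" and e: "0 < e" and r: "0 < r"
    and count: "\<And>m::nat. 0 < m \<Longrightarrow> p * real ((m + 1) ^ n) \<le> 2 ^ N * (e * real m / r + 1) ^ n"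
  shows "real n * log 2 (r / e) + log 2 p \<le> real N"
proof -
  have "(\<lambda>m. (e / r * real m + 1) / (real m + 1)) \<longlonglongrightarrow> e / r"
    using e r by real_asymp
  then have "(\<lambda>m. 2 ^ N * ((e / r * real m + 1) / (real m + 1)) ^ n) \<longlonglongrightarrow> 2 ^ N * (e / r) ^ n"
    by (rule tendsto_mult[OF tendsto_const tendsto_power])
  moreover have "\<exists>M. \<forall>m\<ge>M. p \<le> 2 ^ N * ((e / r * real m + 1) / (real m + 1)) ^ n"
  proof (intro exI allI impI)
    fix m :: nat assume "1 \<le> m"
    then have "p * (real m + 1) ^ n \<le> 2 ^ N * (e / r * real m + 1) ^ n"
      using count[of m] by (simp add: add.commute)
    then show "p \<le> 2 ^ N * ((e / r * real m + 1) / (real m + 1)) ^ n"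
      by (simp add: power_divide pos_le_divide_eq)
  qed
  ultimately have "p \<le> 2 ^ N * (e / r) ^ n"
    by (rule LIMSEQ_le_const)
  then have "(r / e) ^ n * p \<le> 2 ^ N"
    using e r by (simp add: power_divide field_simps)
  then have "log 2 ((r / e) ^ n * p) \<le> log 2 (2 ^ N)"
    using p e r by (subst log_le_cancel_iff) auto
  also have "log 2 ((r / e) ^ n * p) = real n * log 2 (r / e) + log 2 p"
    using p e r by (simp add: log_mult log_nat_power)
  finally show ?thesis by (simp add: log_nat_power)
qed

section \<open>The comparison bounds\<close>

theorem theorem5p4:
  fixes w c\<^sub>0 :: "real ^ 'n" and r\<^sub>0 \<epsilon> :: real and B\<^sub>0 :: "(real ^ 'n) set"
  assumes w_pos: "\<forall>i. 0 < w $ i"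
    and r0_pos: "0 < r\<^sub>0"
    and B0: "B\<^sub>0 = weighted_box c\<^sub>0 (r\<^sub>0 *\<^sub>R w)"
    and eps: "0 < \<epsilon>" "\<epsilon> < r\<^sub>0"
  shows
    "(\<forall>(alg :: (real ^ 'n) algorithm) cmp.
        valid_comparer cmp \<longrightarrow>
        (\<forall>z\<in>B\<^sub>0. locates alg cmp w \<epsilon> z) \<longrightarrow>
        ereal_of_enat (worst_case_comparisons alg cmp B\<^sub>0)
          \<ge> ereal (real CARD('n) * log 2 (r\<^sub>0 / \<epsilon>)))
     \<and>
     (\<forall>(M :: 'w measure) (alg :: 'w \<Rightarrow> (real ^ 'n) algorithm) cmp (N :: nat) (\<delta> :: real).
        prob_space M \<longrightarrow>
        (\<forall>\<omega>\<in>space M. valid_comparer (cmp \<omega>)) \<longrightarrow>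
        (\<forall>\<omega>\<in>space M. worst_case_comparisons (alg \<omega>) (cmp \<omega>) B\<^sub>0 \<le> enat N) \<longrightarrow>
        0 < \<delta> \<longrightarrow> \<delta> < 1 \<longrightarrow>
        (\<forall>z\<in>B\<^sub>0. \<P>(\<omega> in M. locates (alg \<omega>) (cmp \<omega>) w \<epsilon> z) \<ge> 1 - \<delta>) \<longrightarrow>
        real N \<ge> real CARD('n) * log 2 (r\<^sub>0 / \<epsilon>) + log 2 (1 - \<delta>))"
proof (intro conjI allI impI)
  fix alg :: "(real ^ 'n) algorithm" and cmp
  assume located: "\<forall>z\<in>B\<^sub>0. locates alg cmp w \<epsilon> z"
  show "ereal_of_enat (worst_case_comparisons alg cmp B\<^sub>0) \<ge> ereal (real CARD('n) * log 2 (r\<^sub>0 / \<epsilon>))"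
  proof (cases "worst_case_comparisons alg cmp B\<^sub>0")
    case (enat N)
    have "real CARD('n) * log 2 (r\<^sub>0 / \<epsilon>) + log 2 1 \<le> real N"
    proof (rule grid_count_limit)
      fix m :: nat assume m: "0 < m"
      have "{k \<in> grid_indices m. locates alg cmp w \<epsilon> (grid_point c\<^sub>0 r\<^sub>0 w m k)} = grid_indices m"
        using located grid_point_in_weighted_box[OF w_pos r0_pos m] B0 by auto
      moreover have "real (card {k \<in> grid_indices m. locates alg cmp w \<epsilon> (grid_point c\<^sub>0 r\<^sub>0 w m k)})
                       \<le> 2 ^ N * (\<epsilon> * real m / r\<^sub>0 + 1) ^ CARD('n)"
        using enat eps B0 by (intro card_located_grid_indices w_pos r0_pos m) auto
      ultimately show "1 * real ((m + 1) ^ CARD('n)) \<le> 2 ^ N * (\<epsilon> * real m / r\<^sub>0 + 1) ^ CARD('n)"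
        by (simp only: card_grid_indices mult_1)
    qed (use eps r0_pos in auto)
    then show ?thesis using enat by simp
  qed simp
next
  fix M :: "'w measure" and alg :: "'w \<Rightarrow> (real ^ 'n) algorithm" and cmp and N :: nat and \<delta> :: real
  assume "prob_space M"
    and budget: "\<forall>\<omega>\<in>space M. worst_case_comparisons (alg \<omega>) (cmp \<omega>) B\<^sub>0 \<le> enat N"
    and "0 < \<delta>" and \<delta>: "\<delta> < 1"
    and likely: "\<forall>z\<in>B\<^sub>0. \<P>(\<omega> in M. locates (alg \<omega>) (cmp \<omega>) w \<epsilon> z) \<ge> 1 - \<delta>"
  interpret prob_space M by fact
  show "real N \<ge> real CARD('n) * log 2 (r\<^sub>0 / \<epsilon>) + log 2 (1 - \<delta>)"
  proof (rule grid_count_limit)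
    fix m :: nat assume m: "0 < m"
    have "(1 - \<delta>) * real (card (grid_indices m :: ('n \<Rightarrow> nat) set))
            \<le> 2 ^ N * (\<epsilon> * real m / r\<^sub>0 + 1) ^ CARD('n)"
    proof (rule mean_card_events_le)
      fix k :: "'n \<Rightarrow> nat" assume "k \<in> grid_indices m"
      then show "1 - \<delta> \<le> \<P>(\<omega> in M. locates (alg \<omega>) (cmp \<omega>) w \<epsilon> (grid_point c\<^sub>0 r\<^sub>0 w m k))"
        using likely grid_point_in_weighted_box[OF w_pos r0_pos m] B0 by blast
    next
      fix \<omega> assume "\<omega> \<in> space M"
      then show "real (card {k \<in> grid_indices m.
                   locates (alg \<omega>) (cmp \<omega>) w \<epsilon> (grid_point c\<^sub>0 r\<^sub>0 w m k)})
                   \<le> 2 ^ N * (\<epsilon> * real m / r\<^sub>0 + 1) ^ CARD('n)"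
        using budget eps B0 by (intro card_located_grid_indices w_pos r0_pos m) auto
    qed (use \<delta> in \<open>auto simp: finite_grid_indices\<close>)
    then show "(1 - \<delta>) * real ((m + 1) ^ CARD('n)) \<le> 2 ^ N * (\<epsilon> * real m / r\<^sub>0 + 1) ^ CARD('n)"
      by (simp only: card_grid_indices)
  qed (use eps r0_pos \<delta> in auto)
qed

end
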